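(* If the homomorphism $$H_3(\mathrm{SO}(2)_{\mathrm{tor}};\mathbb{Z})\cong\mathbb{Q}/\mathbb{Z}\longrightarrow H_3(B\mathrm{Diff}^{\omega,\delta}_+S^1;\mathbb{Z})$$ induced by the inclusion $\mathrm{SO}(2)_{\mathrm{tor}}\subset\mathrm{Diff}^{\omega,\delta}_+S^1$ is not injective, then $\chi^2\neq0\in H^4(B\mathrm{Diff}^{\omega,\delta}_+S^1;\mathbb{Q})$.
   Context: $\mathrm{Diff}^{\omega,\delta}_+S^1$ is the group of orientation preserving real analytic diffeomorphisms of $S^1=\mathbb{R}/\mathbb{Z}$, with the discrete topology; (co)homology of its classifying space is (co)homology of the abstract group. $\mathrm{SO}(2)_{\mathrm{tor}}\cong\mathbb{Q}/\mathbb{Z}$ is the torsion subgroup of the rotation group $\mathrm{SO}(2)\subset\mathrm{Diff}^{\omega}_+S^1$, i.e. the group of rational rotations, regarded as a discrete group. $\chi\in H^2(B\mathrm{Diff}^{\omega,\delta}_+S^1;\mathbb{Q})$ is the rational Euler class of the universal real analytic flat $S^1$-bundle, i.e. the rational class of the central extension $0\to\mathbb{Z}\to\{f\in\mathrm{Diff}^\omega_+\mathbb{R}: fT=Tf\}\to\mathrm{Diff}^\omega_+S^1\to1$, where $T(x)=x+1$ generates the kernel. *)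

theory Defs
  imports "HOL-Algebra.Free_Abelian_Groups" "HOL-Analysis.FPS_Convergence"
begin

section \<open>Homology and cohomology of an abstract group\<close>

text \<open>The (co)homology of the classifying space of a discrete group is computed by the
  inhomogeneous, unnormalised bar complex.  A generator \<open>[g\<^sub>1|\<dots>|g\<^sub>n]\<close> is a list of length \<open>n\<close>.\<close>

definition bar_cells :: "nat \<Rightarrow> ('a, 'b) monoid_scheme \<Rightarrow> 'a list set" where
  "bar_cells n G = {w. length w = n \<and> set w \<subseteq> carrier G}"

text \<open>The faces of \<open>[g\<^sub>1|\<dots>|g\<^sub>n]\<close> are \<open>[g\<^sub>2|\<dots>|g\<^sub>n]\<close> for \<open>i = 0\<close>, \<open>[g\<^sub>1|\<dots>|g\<^sub>i g\<^sub>i\<^sub>+\<^sub>1|\<dots>|g\<^sub>n]\<close> for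
  \<open>0 < i < n\<close>, and \<open>[g\<^sub>1|\<dots>|g\<^sub>n\<^sub>-\<^sub>1]\<close> for \<open>i = n\<close>.  List positions start at \<open>0\<close>, so \<open>g\<^sub>i\<close> is \<open>w ! (i - 1)\<close>.\<close>

definition bar_face :: "('a, 'b) monoid_scheme \<Rightarrow> nat \<Rightarrow> 'a list \<Rightarrow> 'a list" where
  "bar_face G i w =
     (if i = 0 then tl w
      else if i = length w then butlast w
      else take (i - 1) w @ [w ! (i - 1) \<otimes>\<^bsub>G\<^esub> w ! i] @ drop (i + 1) w)"

subsection \<open>Homology with integer coefficients\<close>

definition bar_chain_group :: "nat \<Rightarrow> ('a, 'b) monoid_scheme \<Rightarrow> ('a list \<Rightarrow>\<^sub>0 int) monoid" where
  "bar_chain_group n G = free_Abelian_group (bar_cells n G)"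

definition bar_boundary ::
    "('a, 'b) monoid_scheme \<Rightarrow> nat \<Rightarrow> ('a list \<Rightarrow>\<^sub>0 int) \<Rightarrow> ('a list \<Rightarrow>\<^sub>0 int)" where
  "bar_boundary G n c =
     (if n = 0 then 0
      else frag_extend (\<lambda>w. \<Sum>i\<le>n. frag_cmul ((-1) ^ i) (frag_of (bar_face G i w))) c)"

definition bar_cycles :: "nat \<Rightarrow> ('a, 'b) monoid_scheme \<Rightarrow> ('a list \<Rightarrow>\<^sub>0 int) set" where
  "bar_cycles n G = kernel (bar_chain_group n G) (bar_chain_group (n - 1) G) (bar_boundary G n)"

definition bar_boundaries :: "nat \<Rightarrow> ('a, 'b) monoid_scheme \<Rightarrow> ('a list \<Rightarrow>\<^sub>0 int) set" where
  "bar_boundaries n G = bar_boundary G (Suc n) ` carrier (bar_chain_group (Suc n) G)"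

definition group_homology ::
    "nat \<Rightarrow> ('a, 'b) monoid_scheme \<Rightarrow> ('a list \<Rightarrow>\<^sub>0 int) set monoid" where
  "group_homology n G = (bar_chain_group n G)\<lparr>carrier := bar_cycles n G\<rparr> Mod bar_boundaries n G"

text \<open>The map induced on homology by a homomorphism \<open>\<phi>\<close> sends the class of a cycle \<open>c\<close> to the
  class of its image.  Here and below, a class is a coset, and the union runs over the
  representatives, all of which yield the same coset.\<close>

definition group_homology_map ::
    "nat \<Rightarrow> ('a, 'b) monoid_scheme \<Rightarrow> ('c, 'd) monoid_scheme \<Rightarrow> ('a \<Rightarrow> 'c)
      \<Rightarrow> ('a list \<Rightarrow>\<^sub>0 int) set \<Rightarrow> ('c list \<Rightarrow>\<^sub>0 int) set" where
  "group_homology_map n G H \<phi> =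
     (\<lambda>X \<in> carrier (group_homology n G).
        \<Union>c\<in>X. bar_boundaries n H #>\<^bsub>bar_chain_group n H\<^esub> frag_extend (frag_of \<circ> map \<phi>) c)"

subsection \<open>Cohomology with trivial coefficients in a commutative ring\<close>

definition bar_cochain_group ::
    "nat \<Rightarrow> ('a, 'b) monoid_scheme \<Rightarrow> ('a list \<Rightarrow> 'r::comm_ring_1) monoid" where
  "bar_cochain_group n G =
     \<lparr>carrier = bar_cells n G \<rightarrow>\<^sub>E UNIV,
      monoid.mult = (\<lambda>f g. \<lambda>w\<in>bar_cells n G. f w + g w),
      one = (\<lambda>w\<in>bar_cells n G. 0)\<rparr>"

definition bar_coboundary ::
    "('a, 'b) monoid_scheme \<Rightarrow> nat \<Rightarrow> ('a list \<Rightarrow> 'r::comm_ring_1) \<Rightarrow> 'a list \<Rightarrow> 'r" where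
  "bar_coboundary G n f =
     (\<lambda>w\<in>bar_cells (Suc n) G. \<Sum>i\<le>Suc n. (-1) ^ i * f (bar_face G i w))"

definition bar_cocycles ::
    "nat \<Rightarrow> ('a, 'b) monoid_scheme \<Rightarrow> ('a list \<Rightarrow> 'r::comm_ring_1) set" where
  "bar_cocycles n G =
     kernel (bar_cochain_group n G) (bar_cochain_group (Suc n) G) (bar_coboundary G n)"

definition bar_coboundaries ::
    "nat \<Rightarrow> ('a, 'b) monoid_scheme \<Rightarrow> ('a list \<Rightarrow> 'r::comm_ring_1) set" where
  "bar_coboundaries n G =
     (if n = 0 then {\<one>\<^bsub>bar_cochain_group 0 G\<^esub>}
      else bar_coboundary G (n - 1) ` carrier (bar_cochain_group (n - 1) G))"

definition group_cohomology ::
    "nat \<Rightarrow> ('a, 'b) monoid_scheme \<Rightarrow> ('a list \<Rightarrow> 'r::comm_ring_1) set monoid" where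
  "group_cohomology n G =
     (bar_cochain_group n G)\<lparr>carrier := bar_cocycles n G\<rparr> Mod bar_coboundaries n G"

text \<open>Cup product, with the convention
  \<open>(f \<union> g)[g\<^sub>1|\<dots>|g\<^sub>p\<^sub>+\<^sub>q] = f[g\<^sub>1|\<dots>|g\<^sub>p] g[g\<^sub>p\<^sub>+\<^sub>1|\<dots>|g\<^sub>p\<^sub>+\<^sub>q]\<close>.  The other common convention differs by
  the sign \<open>(-1)\<^sup>p\<^sup>q\<close>.\<close>

definition cochain_cup ::
    "('a, 'b) monoid_scheme \<Rightarrow> nat \<Rightarrow> nat
      \<Rightarrow> ('a list \<Rightarrow> 'r::comm_ring_1) \<Rightarrow> ('a list \<Rightarrow> 'r) \<Rightarrow> 'a list \<Rightarrow> 'r" where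
  "cochain_cup G p q f g = (\<lambda>w\<in>bar_cells (p + q) G. f (take p w) * g (drop p w))"

definition cup_product ::
    "('a, 'b) monoid_scheme \<Rightarrow> nat \<Rightarrow> nat
      \<Rightarrow> ('a list \<Rightarrow> 'r::comm_ring_1) set \<Rightarrow> ('a list \<Rightarrow> 'r) set \<Rightarrow> ('a list \<Rightarrow> 'r) set" where
  "cup_product G p q X Y =
     (\<Union>f\<in>X. \<Union>g\<in>Y.
        bar_coboundaries (p + q) G #>\<^bsub>bar_cochain_group (p + q) G\<^esub> cochain_cup G p q f g)"

subsection \<open>The class of a central extension by the integers\<close>

text \<open>For a central extension \<open>0 \<rightarrow> \<int> \<rightarrow> E \<rightarrow> G \<rightarrow> 1\<close> with maps \<open>\<iota>\<close> and \<open>\<pi>\<close>, a set-theoretic section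
  \<open>s\<close> of \<open>\<pi>\<close> determines the cocycle \<open>c\<close> with \<open>\<iota> (c[g|h]) = s(g) s(h) s(gh)\<^sup>-\<^sup>1\<close>.  Its class does not
  depend on \<open>s\<close>.  The integer \<open>c[g|h]\<close> is read in the coefficient ring through \<open>of_int\<close>, so that
  for coefficients \<open>rat\<close> this is the rational class of the extension.\<close>

definition extension_sections ::
    "('e, 'f) monoid_scheme \<Rightarrow> ('a, 'b) monoid_scheme \<Rightarrow> ('e \<Rightarrow> 'a) \<Rightarrow> ('a \<Rightarrow> 'e) set" where
  "extension_sections E G \<pi> = {s \<in> carrier G \<rightarrow> carrier E. \<forall>g\<in>carrier G. \<pi> (s g) = g}"

definition extension_cocycle ::
    "('e, 'f) monoid_scheme \<Rightarrow> ('a, 'b) monoid_scheme \<Rightarrow> (int \<Rightarrow> 'e) \<Rightarrow> ('a \<Rightarrow> 'e)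
      \<Rightarrow> 'a list \<Rightarrow> 'r::comm_ring_1" where
  "extension_cocycle E G \<iota> s =
     (\<lambda>w\<in>bar_cells 2 G.
        of_int (THE k. \<iota> k = s (w ! 0) \<otimes>\<^bsub>E\<^esub> s (w ! 1) \<otimes>\<^bsub>E\<^esub> inv\<^bsub>E\<^esub> s (w ! 0 \<otimes>\<^bsub>G\<^esub> w ! 1)))"

definition extension_class ::
    "('e, 'f) monoid_scheme \<Rightarrow> ('a, 'b) monoid_scheme \<Rightarrow> (int \<Rightarrow> 'e) \<Rightarrow> ('e \<Rightarrow> 'a)
      \<Rightarrow> ('a list \<Rightarrow> 'r::comm_ring_1) set" where
  "extension_class E G \<iota> \<pi> =
     (\<Union>s\<in>extension_sections E G \<pi>.
        bar_coboundaries 2 G #>\<^bsub>bar_cochain_group 2 G\<^esub> extension_cocycle E G \<iota> s)"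


section \<open>Real analytic diffeomorphisms of the circle\<close>

quotient_type circle = real / "\<lambda>x y :: real. x - y \<in> \<int>"
  morphisms rep_circle circle_proj
proof (rule equivpI)
  show "reflp (\<lambda>x y :: real. x - y \<in> \<int>)"
    by (simp add: reflp_def)
  show "symp (\<lambda>x y :: real. x - y \<in> \<int>)"
  proof (rule sympI)
    fix x y :: real
    assume "x - y \<in> \<int>"
    from Ints_minus[OF this] show "y - x \<in> \<int>" by simp
  qed
  show "transp (\<lambda>x y :: real. x - y \<in> \<int>)"
  proof (rule transpI)
    fix x y z :: real
    assume "x - y \<in> \<int>" "y - z \<in> \<int>"
    from Ints_add[OF this] show "x - z \<in> \<int>" by simp
  qed
qed

lemma circle_proj_eq_iff: "circle_proj x = circle_proj y \<longleftrightarrow> x - y \<in> \<int>"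
  by (rule circle.abs_eq_iff)

lemma circle_proj_rep: "circle_proj (rep_circle p) = p"
  by (meson Quotient_abs_rep Quotient_circle)

definition real_analytic_at :: "(real \<Rightarrow> real) \<Rightarrow> real \<Rightarrow> bool" where
  "real_analytic_at F x \<longleftrightarrow> (\<exists>A. (\<lambda>t. F (x + t)) has_fps_expansion A)"

text \<open>The charts of the analytic manifold \<open>\<real>/\<int>\<close> are the local inverses of \<open>circle_proj\<close>.  In
  such charts near \<open>x\<close> and its image, a circle map is represented by a local lift to the line.\<close>

definition analytic_local_lift :: "(circle \<Rightarrow> circle) \<Rightarrow> real \<Rightarrow> (real \<Rightarrow> real) \<Rightarrow> bool" where
  "analytic_local_lift f x F \<longleftrightarrow>
     real_analytic_at F x \<and> (\<forall>\<^sub>F t in nhds x. circle_proj (F t) = f (circle_proj t))"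

definition circle_analytic :: "(circle \<Rightarrow> circle) \<Rightarrow> bool" where
  "circle_analytic f \<longleftrightarrow> (\<forall>x. \<exists>F. analytic_local_lift f x F)"

definition circle_orientation_preserving :: "(circle \<Rightarrow> circle) \<Rightarrow> bool" where
  "circle_orientation_preserving f \<longleftrightarrow> (\<forall>x. \<exists>F. analytic_local_lift f x F \<and> 0 < deriv F x)"

definition Diff_circle :: "(circle \<Rightarrow> circle) monoid" where
  "Diff_circle =
     \<lparr>carrier = {f. bij f \<and> circle_analytic f \<and> circle_analytic (inv_into UNIV f)
                    \<and> circle_orientation_preserving f},
      monoid.mult = (\<circ>), one = id\<rparr>"

subsection \<open>Rational rotations\<close>

lift_definition rotation :: "real \<Rightarrow> circle \<Rightarrow> circle" is "\<lambda>a x. x + a"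
  by simp

definition SO2 :: "(circle \<Rightarrow> circle) monoid" where
  "SO2 = Diff_circle\<lparr>carrier := range rotation\<rparr>"

definition SO2_tor :: "(circle \<Rightarrow> circle) monoid" where
  "SO2_tor = SO2\<lparr>carrier := {r \<in> carrier SO2. \<exists>n::nat. 0 < n \<and> r [^]\<^bsub>SO2\<^esub> n = \<one>\<^bsub>SO2\<^esub>}\<rparr>"

lemma rotation_inverse: "inv_into UNIV (rotation a) = rotation (-a)" "bij (rotation a)"
proof -
  have 1: "rotation a (rotation (-a) p) = p" "rotation (-a) (rotation a p) = p" for p
    by (transfer; simp)+
  then show "bij (rotation a)" by (intro bijI') (metis+)
  show "inv_into UNIV (rotation a) = rotation (-a)" using 1 by (intro inv_equality) auto
qed

lemma analytic_local_lift_rotation: "analytic_local_lift (rotation a) x (\<lambda>t. t + a)"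
proof -
  have "(\<lambda>t. x + a + t) has_fps_expansion (fps_const (x + a) + fps_X)"
    by (intro fps_expansion_intros)
  then show ?thesis unfolding analytic_local_lift_def real_analytic_at_def
    by (auto simp: rotation.abs_eq algebra_simps)
qed

lemma rotations_subset_Diff_circle: "range rotation \<subseteq> carrier Diff_circle"
proof -
  have "deriv (\<lambda>t. t + a) x = 1" for a x :: real by (intro DERIV_imp_deriv) (auto intro!: derivative_eq_intros)
  then show ?thesis unfolding Diff_circle_def circle_analytic_def circle_orientation_preserving_def
    by (fastforce simp: rotation_inverse intro: analytic_local_lift_rotation exI[where x="\<lambda>t. t + _"])
qed

lemma SO2_pow_rotation: "rotation a [^]\<^bsub>SO2\<^esub> (n::nat) = rotation (of_nat n * a)"
proof (induction n)
  case 0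
  have "id = rotation 0" apply (rule ext) subgoal for p by transfer simp done
  then show ?case by (simp add: nat_pow_def SO2_def Diff_circle_def)
next
  case (Suc n)
  have *: "rotation x \<circ> rotation y = rotation (x + y)" for x y
    apply (rule ext) subgoal for p apply simp apply transfer by simp done
  from Suc show ?case by (simp add: nat_pow_def SO2_def Diff_circle_def * algebra_simps)
qed

lemma rotation_eq_id_iff: "rotation a = id \<longleftrightarrow> a \<in> \<int>"
proof
  assume "rotation a = id" then have "rotation a (circle_proj 0) = circle_proj 0" by simp
  then show "a \<in> \<int>" by (simp add: rotation.abs_eq circle_proj_eq_iff)
next
  assume "a \<in> \<int>" then show "rotation a = id" apply - apply (rule ext) subgoal for p apply simp apply transfer by simp done
qed

lemma SO2_tor_eq_rational_rotations: "carrier SO2_tor = rotation ` \<rat>"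
proof -
  have "(\<exists>n::nat. 0 < n \<and> of_nat n * a \<in> \<int>) \<longleftrightarrow> a \<in> \<rat>" for a :: real
  proof
    assume "\<exists>n::nat. 0 < n \<and> of_nat n * a \<in> \<int>"
    then obtain n k where "0 < (n::nat)" "of_nat n * a = of_int k" by (blast elim: Ints_cases)
    then have "a = of_int k / of_nat n" by (simp add: field_simps)
    then show "a \<in> \<rat>" by simp
  next
    assume "a \<in> \<rat>"
    then obtain p q where "(q::int) > 0" "a = of_int p / of_int q" using Rats_cases' by metis
    then have "0 < nat q" "of_nat (nat q) * a = of_int p" by auto
    then show "\<exists>n::nat. 0 < n \<and> of_nat n * a \<in> \<int>" by (metis Ints_of_int)
  qed
  moreover have "\<one>\<^bsub>SO2\<^esub> = id" by (simp add: SO2_def Diff_circle_def)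
  moreover have "carrier SO2 = range rotation" by (simp add: SO2_def)
  ultimately have c: "carrier SO2_tor = {r \<in> range rotation. \<exists>n::nat. 0 < n \<and> r [^]\<^bsub>SO2\<^esub> n = id}"
    and q: "\<And>a. (\<exists>n::nat. 0 < n \<and> rotation a [^]\<^bsub>SO2\<^esub> n = id) \<longleftrightarrow> a \<in> \<rat>"
    unfolding SO2_tor_def by (simp_all add: SO2_pow_rotation rotation_eq_id_iff)
  show ?thesis unfolding c using q by blast
qed

subsection \<open>The Euler class\<close>

definition Diff_line_periodic :: "(real \<Rightarrow> real) monoid" where
  "Diff_line_periodic =
     \<lparr>carrier = {F. bij F \<and> (\<forall>x. real_analytic_at F x) \<and> (\<forall>x. real_analytic_at (inv_into UNIV F) x)
                    \<and> (\<forall>x. 0 < deriv F x) \<and> (\<forall>x. F (x + 1) = F x + 1)},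
      monoid.mult = (\<circ>), one = id\<rparr>"

definition line_translation :: "int \<Rightarrow> real \<Rightarrow> real" where
  "line_translation k = (\<lambda>x. x + of_int k)"

text \<open>For \<open>F\<close> commuting with \<open>x \<mapsto> x + 1\<close> this is the map \<open>f\<close> with
  \<open>f (circle_proj x) = circle_proj (F x)\<close>.\<close>

definition circle_descend :: "(real \<Rightarrow> real) \<Rightarrow> circle \<Rightarrow> circle" where
  "circle_descend F = (\<lambda>p. circle_proj (F (rep_circle p)))"

lemma periodic_int: assumes "\<And>x::real. F (x + 1) = F x + (1::real)" shows "F (x + of_int k) = F x + of_int k"
proof (induction k rule: int_induct[where k=0])
  case (step1 i) then show ?case using assms[of "x + of_int i"] by (simp add: algebra_simps)
next
  case (step2 i) then show ?case using assms[of "x + of_int i - 1"] by (simp add: algebra_simps)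
qed simp

lemma circle_descend_proj: assumes "\<And>x. F (x + 1) = F x + (1::real)"
  shows "circle_descend F (circle_proj x) = circle_proj (F x)"
proof -
  have "rep_circle (circle_proj x) - x \<in> \<int>" using circle_proj_eq_iff circle_proj_rep by metis
  then obtain k where k: "rep_circle (circle_proj x) - x = of_int k" by (auto elim: Ints_cases)
  then have "rep_circle (circle_proj x) = x + of_int k" by simp
  then show ?thesis unfolding circle_descend_def
    by (simp add: periodic_int[of F, OF assms] circle_proj_eq_iff)
qed

definition euler_class :: "((circle \<Rightarrow> circle) list \<Rightarrow> rat) set" where
  "euler_class = extension_class Diff_line_periodic Diff_circle line_translation circle_descend"

end

theory Submission
  imports Defs "HOL-Complex_Analysis.Laurent_Convergence"
begin

text \<open>Suppose that the square of the integral Euler cocycle \<open>e\<close> is the coboundary of a rational cochain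
  \<open>u\<close>, and let \<open>x\<close> be a 3-cycle of rational rotations that bounds a chain \<open>y\<close> of diffeomorphisms.
  Then \<open>u(x) = (e \<union> e)(y)\<close> is an integer.  On rational rotations \<open>e\<close> is the coboundary of the angle
  \<open>\<theta>\<close> with values in \<open>[0, 1)\<close>, so \<open>u\<close> and \<open>\<theta> \<union> e\<close> differ there by a rational cocycle, which
  vanishes on the torsion class of \<open>x\<close>; hence \<open>\<theta> \<union> e\<close> is integral on \<open>x\<close>.  But \<open>\<theta> \<union> e\<close>
  detects the third homology: \<open>x\<close> lives on a finite cyclic subgroup of some order \<open>n\<close> with
  generator \<open>t\<close>, whose third homology is generated by the \<open>n\<close>-torsion class of
  \<open>\<Sum>k<n. [t|t\<^sup>k|t]\<close>, and on that cycle \<open>\<theta> \<union> e\<close> takes the value \<open>1/n\<close>.  So \<open>x\<close> is a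
  boundary of rational rotations.\<close>

section \<open>Pairing of cochains with chains\<close>

text \<open>The Kronecker pairing: only the values of \<open>u\<close> on the support of
  \<open>c\<close> enter.\<close>

definition chain_eval :: "('a \<Rightarrow> 'r::comm_ring_1) \<Rightarrow> ('a \<Rightarrow>\<^sub>0 int) \<Rightarrow> 'r" where
  "chain_eval u c = (\<Sum>w\<in>Poly_Mapping.keys c. of_int (poly_mapping.lookup c w) * u w)"

lemma chain_eval_superset:
  assumes "finite S" "Poly_Mapping.keys c \<subseteq> S"
  shows "chain_eval u c = (\<Sum>w\<in>S. of_int (poly_mapping.lookup c w) * u w)"
  unfolding chain_eval_def using assms
  by (intro sum.mono_neutral_left) (auto simp: in_keys_iff)

lemma chain_eval_0 [simp]: "chain_eval u 0 = 0"
  by (simp add: chain_eval_def)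

lemma chain_eval_frag_of [simp]: "chain_eval u (frag_of w) = u w"
  by (simp add: chain_eval_def)

lemma chain_eval_add: "chain_eval u (a + b) = chain_eval u a + chain_eval u b"
proof -
  let ?S = "Poly_Mapping.keys a \<union> Poly_Mapping.keys b"
  have "Poly_Mapping.keys (a + b) \<subseteq> ?S" by (rule keys_add)
  then show ?thesis
    by (simp add: chain_eval_superset[of ?S] lookup_add distrib_right sum.distrib)
qed

lemma chain_eval_cmul: "chain_eval u (frag_cmul k c) = of_int k * chain_eval u c"
proof -
  have "Poly_Mapping.keys (frag_cmul k c) \<subseteq> Poly_Mapping.keys c" by (rule keys_cmul)
  then show ?thesis
    by (simp add: chain_eval_superset[of "Poly_Mapping.keys c"] sum_distrib_left mult.assoc)
qed

lemma chain_eval_diff: "chain_eval u (a - b) = chain_eval u a - chain_eval u b"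
  using chain_eval_add[of u "a - b" b] by simp

lemma chain_eval_sum: "chain_eval u (sum c I) = (\<Sum>i\<in>I. chain_eval u (c i))"
  by (induction I rule: infinite_finite_induct) (simp_all add: chain_eval_add)

lemma chain_eval_cong:
  assumes "\<And>w. w \<in> Poly_Mapping.keys c \<Longrightarrow> u w = v w"
  shows "chain_eval u c = chain_eval v c"
  using assms by (simp add: chain_eval_def)

lemma chain_eval_Ints:
  assumes "\<And>w. w \<in> Poly_Mapping.keys c \<Longrightarrow> u w \<in> \<int>"
  shows "chain_eval u c \<in> \<int>"
  using assms unfolding chain_eval_def by (intro Ints_sum Ints_mult Ints_of_int)

section \<open>Linearity of the boundary and the subgroup of boundaries\<close>

lemma bar_boundary_0 [simp]: "bar_boundary G n 0 = 0"
  by (simp add: bar_boundary_def)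

lemma bar_boundary_diff: "bar_boundary G n (a - b) = bar_boundary G n a - bar_boundary G n b"
  by (simp add: bar_boundary_def frag_extend_diff)

lemma bar_boundary_cmul: "bar_boundary G n (frag_cmul k a) = frag_cmul k (bar_boundary G n a)"
  by (simp add: bar_boundary_def frag_extend_cmul)

lemma bar_boundary_frag_of:
  "bar_boundary G (Suc n) (frag_of w) =
     (\<Sum>i\<le>Suc n. frag_cmul ((-1) ^ i) (frag_of (bar_face G i w)))"
  by (simp add: bar_boundary_def del: sum.atMost_Suc)

text \<open>Both sides are additive in \<open>z\<close>, and on a cell both are the alternating sum
  over its faces. The support condition keeps \<open>z\<close> where \<open>bar_coboundary\<close>
  is not \<open>undefined\<close>.\<close>

lemma chain_eval_boundary:
  assumes "Poly_Mapping.keys z \<subseteq> bar_cells (Suc n) G"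
  shows "chain_eval u (bar_boundary G (Suc n) z) = chain_eval (bar_coboundary G n u) z"
  using assms
proof (induction z rule: frag_induction)
  case (one w)
  then show ?case
    by (simp add: bar_boundary_frag_of bar_coboundary_def chain_eval_sum chain_eval_cmul
             del: sum.atMost_Suc)
qed (simp_all add: bar_boundary_diff chain_eval_diff)

lemma bar_boundaries_iff:
  "b \<in> bar_boundaries n G \<longleftrightarrow>
     (\<exists>z. Poly_Mapping.keys z \<subseteq> bar_cells (Suc n) G \<and> b = bar_boundary G (Suc n) z)"
  by (simp add: bar_boundaries_def bar_chain_group_def image_iff Bex_def)

lemma bar_boundaries_0 [simp]: "0 \<in> bar_boundaries n G"
  unfolding bar_boundaries_iff by (intro exI[of _ 0]) simp

lemma bar_boundaries_diff:
  assumes "a \<in> bar_boundaries n G" "b \<in> bar_boundaries n G"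
  shows "a - b \<in> bar_boundaries n G"
proof -
  obtain y z where "Poly_Mapping.keys y \<subseteq> bar_cells (Suc n) G" "a = bar_boundary G (Suc n) y"
    "Poly_Mapping.keys z \<subseteq> bar_cells (Suc n) G" "b = bar_boundary G (Suc n) z"
    using assms by (auto simp: bar_boundaries_iff)
  then show ?thesis unfolding bar_boundaries_iff
    by (intro exI[of _ "y - z"]) (use keys_diff[of y z] in \<open>auto simp: bar_boundary_diff\<close>)
qed

lemma bar_boundaries_add:
  assumes "a \<in> bar_boundaries n G" "b \<in> bar_boundaries n G"
  shows "a + b \<in> bar_boundaries n G"
  using bar_boundaries_diff[OF assms(1) bar_boundaries_diff[OF bar_boundaries_0 assms(2)]] by simp

lemma bar_boundaries_sum:
  assumes "\<And>i. i \<in> I \<Longrightarrow> f i \<in> bar_boundaries n G"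
  shows "sum f I \<in> bar_boundaries n G"
  using assms by (induction I rule: infinite_finite_induct) (auto intro: bar_boundaries_add)

lemma bar_boundaries_cmul:
  assumes "a \<in> bar_boundaries n G"
  shows "frag_cmul k a \<in> bar_boundaries n G"
proof -
  obtain z where "Poly_Mapping.keys z \<subseteq> bar_cells (Suc n) G" "a = bar_boundary G (Suc n) z"
    using assms by (auto simp: bar_boundaries_iff)
  then show ?thesis unfolding bar_boundaries_iff
    by (intro exI[of _ "frag_cmul k z"]) (use keys_cmul[of k z] in \<open>auto simp: bar_boundary_cmul\<close>)
qed

section \<open>Explicit formulas in low degrees\<close>

lemma bar_boundary_3:
  "bar_boundary G 3 (frag_of [a, b, c]) =
     frag_of [b, c] - frag_of [a \<otimes>\<^bsub>G\<^esub> b, c] + frag_of [a, b \<otimes>\<^bsub>G\<^esub> c] - frag_of [a, b]"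
  by (simp add: bar_boundary_def eval_nat_numeral bar_face_def)

lemma bar_boundary_4:
  "bar_boundary G 4 (frag_of [a, b, c, d]) =
     frag_of [b, c, d] - frag_of [a \<otimes>\<^bsub>G\<^esub> b, c, d] + frag_of [a, b \<otimes>\<^bsub>G\<^esub> c, d]
       - frag_of [a, b, c \<otimes>\<^bsub>G\<^esub> d] + frag_of [a, b, c]"
  by (simp add: bar_boundary_def eval_nat_numeral bar_face_def)

lemma bar_coboundary_3:
  assumes "{a, b, c, d} \<subseteq> carrier G"
  shows "bar_coboundary G 3 u [a, b, c, d] =
     u [b, c, d] - u [a \<otimes>\<^bsub>G\<^esub> b, c, d] + u [a, b \<otimes>\<^bsub>G\<^esub> c, d]
       - u [a, b, c \<otimes>\<^bsub>G\<^esub> d] + u [a, b, c]"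
  using assms by (simp add: bar_coboundary_def bar_cells_def eval_nat_numeral bar_face_def)

section \<open>Third homology of a finite cyclic group\<close>

text \<open>A cyclic subgroup of order \<open>n\<close>, indexed by all natural exponents: products
  become plain sums, and reduction modulo \<open>n\<close> enters only through periodicity.\<close>

locale cyclic_param =
  fixes G :: "('a, 'b) monoid_scheme" and t :: "nat \<Rightarrow> 'a" and n :: nat
  assumes n_pos: "0 < n"
    and t_carrier: "t i \<in> carrier G"
    and t_add: "t i \<otimes>\<^bsub>G\<^esub> t j = t (i + j)"
    and t_eq_iff: "t i = t j \<longleftrightarrow> i mod n = j mod n"
begin

abbreviation cell :: "nat \<Rightarrow> nat \<Rightarrow> nat \<Rightarrow> 'a list \<Rightarrow>\<^sub>0 int" where
  "cell i j k \<equiv> frag_of [t i, t j, t k]"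

abbreviation B :: "('a list \<Rightarrow>\<^sub>0 int) set" where
  "B \<equiv> bar_boundaries 3 G"

text \<open>A cycle for each \<open>i\<close>: its faces cancel because \<open>k\<close>,
  \<open>k + 1\<close> and \<open>i + k\<close> all run over the residues. A carry in
  \<open>primitive i\<close> costs \<open>norm_cycle i\<close>.\<close>

definition norm_cycle :: "nat \<Rightarrow> 'a list \<Rightarrow>\<^sub>0 int" where
  "norm_cycle i = (\<Sum>k<n. cell i k 1)"

text \<open>Modulo boundaries \<open>cell\<close> is the universal 3-cocycle.  Pulled back along \<open>t\<close> to the free
  monoid \<open>nat\<close>, it becomes the coboundary of the following 2-cochain; the failure of the latter to
  be periodic in its second argument produces the class of \<open>norm_cycle 1\<close>.  The term \<open>cell i 0 0\<close>
  accounts for the degenerate cells of the unnormalised complex.\<close>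

definition primitive :: "nat \<Rightarrow> nat \<Rightarrow> 'a list \<Rightarrow>\<^sub>0 int" where
  "primitive i j = (\<Sum>k<j. cell i k 1) - cell i 0 0"

lemma t_mod: "t (i mod n) = t i" by (simp add: t_eq_iff)

lemma t_add_n: "t (i + n) = t i" by (simp add: t_eq_iff)

text \<open>This is the boundary of one 4-cell, read as a cocycle identity modulo
  \<open>B\<close>.\<close>

lemma cocycle:
  "cell j k l - cell (i + j) k l + cell i (j + k) l - cell i j (k + l) + cell i j k \<in> B"
proof -
  have "bar_boundary G 4 (frag_of [t i, t j, t k, t l]) \<in> B"
    unfolding bar_boundaries_iff
    by (intro exI[of _ "frag_of [t i, t j, t k, t l]"]) (simp add: bar_cells_def t_carrier)
  then show ?thesis by (simp add: bar_boundary_4 t_add)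
qed

text \<open>Summing the cocycle identity with last argument 1 over its third argument telescopes
  from \<open>cell i j 0\<close> to \<open>cell i j k\<close>.\<close>

lemma cell_primitive:
  "cell i j k
     - (primitive j k - primitive (i + j) k + primitive i (j + k) - primitive i j) \<in> B"
proof -
  let ?R = "\<lambda>k l. cell j k l - cell (i + j) k l + cell i (j + k) l - cell i j (k + l) + cell i j k"
  have *: "(\<Sum>m<k. ?R m 1) = primitive j k - primitive (i + j) k + primitive i (j + k)
      - primitive i j - cell i j k + cell j 0 0 - cell (i + j) 0 0 + cell i j 0"
    by (induction k) (simp_all add: primitive_def algebra_simps)
  \<comment> \<open>The instance \<open>?R 0 0\<close> equals exactly the degenerate cells left over
    by the telescoping.\<close>
  have "?R 0 0 - (\<Sum>m<k. ?R m 1) \<in> B"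
    by (intro bar_boundaries_diff bar_boundaries_sum cocycle)
  then show ?thesis unfolding * by (simp add: algebra_simps)
qed

lemma primitive_add_n: "primitive i (j + n) = primitive i j + norm_cycle i"
proof (induction j)
  case 0
  then show ?case by (simp add: primitive_def norm_cycle_def)
next
  case (Suc j)
  then show ?case by (simp add: primitive_def t_add_n)
qed

text \<open>The same telescoping over a full period: \<open>cell i j n\<close> equals
  \<open>cell i j 0\<close>, and shifting \<open>primitive i\<close> by \<open>n\<close> adds
  \<open>norm_cycle i\<close>.\<close>

lemma norm_cycle_hom: "norm_cycle j - norm_cycle (i + j) + norm_cycle i \<in> B"
proof -
  let ?R = "\<lambda>k l. cell j k l - cell (i + j) k l + cell i (j + k) l - cell i j (k + l) + cell i j k"
  have *: "(\<Sum>m<k. ?R m 1) = (\<Sum>m<k. cell j m 1) - (\<Sum>m<k. cell (i + j) m 1)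
      + primitive i (j + k) - primitive i j - cell i j k + cell i j 0" for k
    by (induction k) (simp_all add: primitive_def algebra_simps)
  have "(\<Sum>m<n. ?R m 1) \<in> B"
    by (intro bar_boundaries_sum cocycle)
  then show ?thesis unfolding * primitive_add_n
    using t_add_n[of 0] by (simp add: norm_cycle_def)
qed

lemma norm_cycle_eq_cmul: "norm_cycle i - frag_cmul (int i) (norm_cycle 1) \<in> B"
proof (induction i)
  case 0
  then show ?case using norm_cycle_hom[of 0 0] by simp
next
  case (Suc i)
  have "(norm_cycle i - frag_cmul (int i) (norm_cycle 1))
      - (norm_cycle i - norm_cycle (1 + i) + norm_cycle 1) \<in> B"
    by (rule bar_boundaries_diff[OF Suc norm_cycle_hom])
  then show ?case
    by (simp add: frag_cmul_distrib algebra_simps del: minus_frag_cmul)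
qed

text \<open>By additivity this is homologous to \<open>norm_cycle n\<close>, which equals
  \<open>norm_cycle 0\<close> because \<open>t n = t 0\<close>.\<close>

lemma cmul_norm_cycle_boundary: "frag_cmul (int n) (norm_cycle 1) \<in> B"
proof -
  have "norm_cycle n = norm_cycle 0"
    using t_add_n[of 0] by (simp add: norm_cycle_def)
  moreover have "norm_cycle 0 \<in> B" using norm_cycle_eq_cmul[of 0] by simp
  ultimately show ?thesis
    using bar_boundaries_diff[OF _ norm_cycle_eq_cmul[of n]] by force
qed

text \<open>As \<open>j + k < 2 * n\<close>, at most one carry occurs; it costs
  \<open>norm_cycle i\<close>, homologous to \<open>i\<close> times
  \<open>norm_cycle 1\<close>.\<close>

lemma primitive_mod:
  assumes "j < n" "k < n"
  shows "\<exists>m. primitive i (j + k) - primitive i ((j + k) mod n) - frag_cmul m (norm_cycle 1) \<in> B"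
proof (cases "j + k < n")
  case True
  then show ?thesis by (intro exI[of _ 0]) simp
next
  case False
  with assms have "(j + k) mod n + n = j + k"
    by (simp add: le_mod_geq)
  then have "primitive i (j + k) - primitive i ((j + k) mod n) = norm_cycle i"
    using primitive_add_n[of i "(j + k) mod n"] by simp
  then show ?thesis using norm_cycle_eq_cmul[of i] by metis
qed

text \<open>The chosen exponent is determined only modulo \<open>n\<close>; on the range of
  \<open>t\<close> the reduction makes it the least one.\<close>

definition index :: "'a \<Rightarrow> nat" where
  "index g = (SOME i. t i = g) mod n"

lemma index_t [simp]: "index (t i) = i mod n"
  unfolding index_def using someI[of "\<lambda>j. t j = t i" i] by (simp add: t_eq_iff)

lemma primitive_mod_left: "primitive (i mod n) j = primitive i j"
  by (simp add: primitive_def t_mod)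

text \<open>Modulo boundaries and multiples of \<open>norm_cycle 1\<close>, every cell agrees with a
  linear function \<open>h\<close> of its boundary, and \<open>h\<close> contributes nothing on a
  cycle.\<close>

lemma cycle_homologous_multiple_norm:
  assumes "Poly_Mapping.keys x \<subseteq> {w. length w = 3 \<and> set w \<subseteq> range t}"
    and "bar_boundary G 3 x = 0"
  shows "\<exists>m. x - frag_cmul m (norm_cycle 1) \<in> B"
proof -
  define h where "h = frag_extend (\<lambda>w. primitive (index (w ! 0)) (index (w ! 1)))"
  \<comment> \<open>Stated for chains that need not be cycles, so that induction over generators
    applies.\<close>
  have "\<exists>m. x - h (bar_boundary G 3 x) - frag_cmul m (norm_cycle 1) \<in> B"
    using assms(1)
  proof (induction x rule: frag_induction)
    case zero
    show ?case by (intro exI[of _ 0]) (simp add: h_def)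
  next
    case (diff x y)
    then obtain m k where "x - h (bar_boundary G 3 x) - frag_cmul m (norm_cycle 1) \<in> B"
      "y - h (bar_boundary G 3 y) - frag_cmul k (norm_cycle 1) \<in> B" by blast
    from bar_boundaries_diff[OF this] show ?case
      by (intro exI[of _ "m - k"])
        (simp add: bar_boundary_diff h_def frag_extend_diff frag_cmul_diff_distrib algebra_simps)
  next
    case (one w)
    then obtain i' j' k' where "w = [t i', t j', t k']"
      by (auto simp: length_Suc_conv eval_nat_numeral)
    then obtain i j k where w: "w = [t i, t j, t k]" and l: "i < n" "j < n" "k < n"
      using t_mod n_pos by (metis mod_less_divisor)
    obtain m where m: "primitive i (j + k) - primitive i ((j + k) mod n)
        - frag_cmul m (norm_cycle 1) \<in> B"
      using primitive_mod l by blast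
    \<comment> \<open>Reducing \<open>i + j\<close> is harmless by
      \<open>primitive_mod_left\<close>; only the second argument \<open>j + k\<close> feels the
      carry.\<close>
    have "h (bar_boundary G 3 (frag_of w)) =
        primitive j k - primitive (i + j) k + primitive i ((j + k) mod n) - primitive i j"
      using l by (simp add: w h_def bar_boundary_3 frag_extend_diff frag_extend_add t_add
          primitive_mod_left)
    then have "frag_of w - h (bar_boundary G 3 (frag_of w)) - frag_cmul m (norm_cycle 1) =
        (cell i j k
          - (primitive j k - primitive (i + j) k + primitive i (j + k) - primitive i j))
        + (primitive i (j + k) - primitive i ((j + k) mod n) - frag_cmul m (norm_cycle 1))"
      by (simp add: w)
    with bar_boundaries_add[OF cell_primitive[of i j k] m] show ?case by metis
  qed
  then show ?thesis using assms(2) by (simp add: h_def)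
qed

end
section \<open>Composition of real analytic maps\<close>

definition fps_complexify :: "real fps \<Rightarrow> complex fps" where
  "fps_complexify A = Abs_fps (\<lambda>n. of_real (fps_nth A n))"

lemma fps_complexify_nth [simp]: "fps_nth (fps_complexify A) n = of_real (fps_nth A n)"
  by (simp add: fps_complexify_def)

lemma fps_complexify_1: "fps_complexify 1 = 1"
  by (simp add: fps_eq_iff)

lemma fps_complexify_mult: "fps_complexify (A * C) = fps_complexify A * fps_complexify C"
  by (simp add: fps_eq_iff fps_mult_nth)

lemma fps_complexify_power: "fps_complexify (A ^ k) = fps_complexify A ^ k"
  by (induction k) (simp_all add: fps_complexify_1 fps_complexify_mult)

lemma fps_complexify_compose:
  "fps_complexify (fps_compose A C) = fps_compose (fps_complexify A) (fps_complexify C)"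
  by (simp add: fps_eq_iff fps_compose_nth flip: fps_complexify_power)

lemma fps_conv_radius_complexify [simp]: "fps_conv_radius (fps_complexify A) = fps_conv_radius A"
  unfolding fps_conv_radius_def
  using conv_radius_norm[of "fps_nth A"] conv_radius_norm[of "fps_nth (fps_complexify A)"]
  by simp

lemma eval_fps_complexify:
  assumes "ereal (norm x) < fps_conv_radius A"
  shows "eval_fps (fps_complexify A) (of_real x) = of_real (eval_fps A x)"
proof -
  have "summable (\<lambda>n. fps_nth A n * x ^ n)"
    using assms by (intro summable_in_conv_radius) (simp add: fps_conv_radius_def)
  then show ?thesis by (simp add: eval_fps_def suminf_of_real)
qed

lemma has_fps_expansion_complexify:
  assumes "f has_fps_expansion A"
  shows "\<forall>\<^sub>F x in nhds 0. eval_fps (fps_complexify A) (of_real x) = of_real (f x)"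
proof -
  have "\<forall>\<^sub>F x in nhds (0::real). x \<in> eball 0 (fps_conv_radius A)"
    using assms by (intro eventually_nhds_in_open) (auto simp: has_fps_expansion_def zero_ereal_def)
  moreover have "\<forall>\<^sub>F x in nhds 0. eval_fps A x = f x"
    using assms by (simp add: has_fps_expansion_def)
  ultimately show ?thesis
    by eventually_elim (simp add: eval_fps_complexify)
qed

text \<open>The library composes expansions of complex functions only, by way of residues; the real case
  follows by extending both power series to the complex plane.\<close>

lemma has_fps_expansion_compose_real:
  fixes f g :: "real \<Rightarrow> real"
  assumes f: "f has_fps_expansion A" and g: "g has_fps_expansion C" and C0: "fps_nth C 0 = 0"
  shows "(f \<circ> g) has_fps_expansion (fps_compose A C)"
proof -
  let ?c = "fps_complexify"
  have "(eval_fps (?c A) \<circ> eval_fps (?c C)) has_fps_expansion fps_compose (?c A) (?c C)"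
    using f g C0 by (intro has_fps_expansion_compose eval_fps_has_fps_expansion)
      (auto simp: has_fps_expansion_def)
  then have c: "fps_conv_radius (fps_compose A C) > 0"
    "\<forall>\<^sub>F z in nhds 0. eval_fps (?c (fps_compose A C)) z = eval_fps (?c A) (eval_fps (?c C) z)"
    by (simp_all add: has_fps_expansion_def fps_conv_radius_complexify[symmetric]
        fps_complexify_compose del: fps_conv_radius_complexify)
  have "((of_real :: real \<Rightarrow> complex) \<longlongrightarrow> of_real 0) (nhds 0)"
    by (intro tendsto_of_real) (simp add: filterlim_ident)
  then have "\<forall>\<^sub>F x in nhds (0::real). eval_fps (?c (fps_compose A C)) (of_real x) =
      eval_fps (?c A) (eval_fps (?c C) (of_real x))"
    using eventually_compose_filterlim[OF c(2)] by simp
  \<comment> \<open>Since the constant term of \<open>C\<close> is 0, \<open>g x\<close> eventually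
    lies where \<open>A\<close> represents \<open>f\<close>.\<close>
  moreover have "(g \<longlongrightarrow> 0) (nhds 0)"
    using has_fps_expansion_imp_continuous[OF g, of UNIV] has_fps_expansion_imp_0_eq_fps_nth_0[OF g] C0
      tendsto_at_iff_tendsto_nhds[of g 0]
    by (simp add: isCont_def)
  then have "\<forall>\<^sub>F x in nhds 0. eval_fps (?c A) (of_real (g x)) = of_real (f (g x))"
    by (rule eventually_compose_filterlim[OF has_fps_expansion_complexify[OF f]])
  moreover have "\<forall>\<^sub>F x in nhds (0::real). x \<in> eball 0 (fps_conv_radius (fps_compose A C))"
    using c(1) by (intro eventually_nhds_in_open) (auto simp: zero_ereal_def)
  ultimately have "\<forall>\<^sub>F x in nhds 0. eval_fps (fps_compose A C) x = (f \<circ> g) x"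
    using has_fps_expansion_complexify[OF g]
  proof eventually_elim
    case (elim x)
    then have "of_real (eval_fps (fps_compose A C) x) = (of_real (f (g x)) :: complex)"
      by (simp add: eval_fps_complexify[symmetric])
    then show ?case by simp
  qed
  with c(1) show ?thesis by (simp add: has_fps_expansion_def)
qed

lemma real_analytic_at_compose:
  assumes G: "real_analytic_at G x" and F: "real_analytic_at F (G x)"
  shows "real_analytic_at (F \<circ> G) x"
proof -
  obtain A C where A: "(\<lambda>t. F (G x + t)) has_fps_expansion A"
    and C: "(\<lambda>t. G (x + t)) has_fps_expansion C"
    using F G by (auto simp: real_analytic_at_def)
  \<comment> \<open>Recentring at \<open>G x\<close> gives the inner series the zero constant term
    that composition requires.\<close>
  have "(\<lambda>t. G (x + t) - G x) has_fps_expansion (C - fps_const (G x))"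
    by (intro fps_expansion_intros C)
  moreover have "fps_nth (C - fps_const (G x)) 0 = 0"
    using has_fps_expansion_imp_0_eq_fps_nth_0[OF C] by simp
  ultimately have "((\<lambda>t. F (G x + t)) \<circ> (\<lambda>t. G (x + t) - G x)) has_fps_expansion
      (fps_compose A (C - fps_const (G x)))"
    by (rule has_fps_expansion_compose_real[OF A])
  then show ?thesis by (auto simp: real_analytic_at_def comp_def)
qed

text \<open>The expansion is differentiated termwise; this makes \<open>deriv\<close> in the
  orientation condition an actual derivative, so that the chain rule applies.\<close>

lemma real_analytic_at_imp_DERIV:
  assumes "real_analytic_at F x"
  shows "DERIV F x :> deriv F x"
proof -
  obtain A where A: "(\<lambda>t. F (x + t)) has_fps_expansion A"
    using assms by (auto simp: real_analytic_at_def)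
  have "(eval_fps A has_field_derivative eval_fps (fps_deriv A) 0) (at 0)"
    using A by (intro has_field_derivative_eval_fps) (auto simp: has_fps_expansion_def zero_ereal_def)
  moreover have "\<forall>\<^sub>F t in nhds 0. eval_fps A t = F (x + t)"
    using A by (simp add: has_fps_expansion_def)
  ultimately have "((\<lambda>t. F (x + t)) has_field_derivative eval_fps (fps_deriv A) 0) (at 0)"
    by (subst (asm) DERIV_cong_ev[OF refl _ refl])
  then have "DERIV F x :> eval_fps (fps_deriv A) 0"
    using DERIV_shift[of F _ 0 x] by (simp add: add.commute)
  then show ?thesis using DERIV_imp_deriv by metis
qed

text \<open>Continuity of \<open>G\<close> pulls the neighbourhood of \<open>G x\<close> on which
  \<open>F\<close> lifts \<open>f\<close> back to a neighbourhood of \<open>x\<close>.\<close>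

lemma analytic_local_lift_comp:
  assumes G: "analytic_local_lift g x G" and F: "analytic_local_lift f (G x) F"
  shows "analytic_local_lift (f \<circ> g) x (F \<circ> G)"
proof -
  have "isCont G x"
    using G by (intro DERIV_isCont[OF real_analytic_at_imp_DERIV]) (simp add: analytic_local_lift_def)
  then have "(G \<longlongrightarrow> G x) (nhds x)"
    by (simp add: isCont_def tendsto_at_iff_tendsto_nhds)
  moreover have "\<forall>\<^sub>F t in nhds (G x). circle_proj (F t) = f (circle_proj t)"
    using F by (simp add: analytic_local_lift_def)
  ultimately have "\<forall>\<^sub>F t in nhds x. circle_proj (F (G t)) = f (circle_proj (G t))"
    using eventually_compose_filterlim by blast
  moreover have "\<forall>\<^sub>F t in nhds x. circle_proj (G t) = g (circle_proj t)"
    using G by (simp add: analytic_local_lift_def)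
  ultimately have "\<forall>\<^sub>F t in nhds x. circle_proj ((F \<circ> G) t) = (f \<circ> g) (circle_proj t)"
    by eventually_elim simp
  then show ?thesis
    using F G real_analytic_at_compose by (auto simp: analytic_local_lift_def)
qed

lemma circle_analytic_comp:
  assumes "circle_analytic f" "circle_analytic g"
  shows "circle_analytic (f \<circ> g)"
  using assms analytic_local_lift_comp unfolding circle_analytic_def by meson

lemma circle_orientation_preserving_comp:
  assumes f: "circle_orientation_preserving f" and g: "circle_orientation_preserving g"
  shows "circle_orientation_preserving (f \<circ> g)"
  unfolding circle_orientation_preserving_def
proof
  fix x
  obtain G where G: "analytic_local_lift g x G" "0 < deriv G x"
    using g by (auto simp: circle_orientation_preserving_def)
  obtain F where F: "analytic_local_lift f (G x) F" "0 < deriv F (G x)"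
    using f by (auto simp: circle_orientation_preserving_def)
  have "DERIV G x :> deriv G x" "DERIV F (G x) :> deriv F (G x)"
    using F(1) G(1) by (auto simp: analytic_local_lift_def intro: real_analytic_at_imp_DERIV)
  then have "deriv (F \<circ> G) x = deriv F (G x) * deriv G x"
    by (intro DERIV_imp_deriv DERIV_chain)
  then show "\<exists>H. analytic_local_lift (f \<circ> g) x H \<and> 0 < deriv H x"
    using analytic_local_lift_comp[OF G(1) F(1)] F(2) G(2) by auto
qed

text \<open>Used at the end to see that faces of cells are cells, so that cocycles lie in their own
  cosets.\<close>

lemma Diff_circle_comp_closed:
  assumes "f \<in> carrier Diff_circle" "g \<in> carrier Diff_circle"
  shows "f \<circ> g \<in> carrier Diff_circle"
proof -
  have "inv_into UNIV (f \<circ> g) = inv_into UNIV g \<circ> inv_into UNIV f"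
    using assms by (intro o_inv_distrib) (auto simp: Diff_circle_def)
  then show ?thesis using assms
    by (auto simp: Diff_circle_def bij_comp circle_analytic_comp circle_orientation_preserving_comp)
qed

section \<open>Rational rotations and their lifts\<close>

abbreviation rat_rotation :: "rat \<Rightarrow> circle \<Rightarrow> circle" where
  "rat_rotation q \<equiv> rotation (of_rat q)"

lemma carrier_SO2_tor: "carrier SO2_tor = range rat_rotation"
  unfolding SO2_tor_eq_rational_rotations Rats_def by (simp add: image_comp comp_def)

lemma mult_SO2_tor: "r \<otimes>\<^bsub>SO2_tor\<^esub> s = r \<circ> s"
  by (simp add: SO2_tor_def SO2_def Diff_circle_def)

lemma mult_Diff_circle: "r \<otimes>\<^bsub>Diff_circle\<^esub> s = r \<circ> s"
  by (simp add: Diff_circle_def)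

lemma carrier_SO2_tor_subset: "carrier SO2_tor \<subseteq> carrier Diff_circle"
  using rotations_subset_Diff_circle carrier_SO2_tor by auto

lemma bar_face_SO2_tor: "bar_face SO2_tor = bar_face Diff_circle"
  by (simp add: fun_eq_iff bar_face_def mult_SO2_tor mult_Diff_circle)

lemma rotation_comp: "rotation a \<circ> rotation b = rotation (a + b)"
proof
  fix p show "(rotation a \<circ> rotation b) p = rotation (a + b) p"
    unfolding comp_apply by transfer simp
qed

lemma rotation_eq_iff: "rotation a = rotation b \<longleftrightarrow> a - b \<in> \<int>"
proof -
  have "rotation a = rotation b \<longleftrightarrow> rotation (a - b) = id"
    using rotation_comp[of "a - b" b] rotation_comp[of a "- b"] rotation_comp[of b "- b"]
      rotation_eq_id_iff[of 0] by auto
  then show ?thesis by (simp add: rotation_eq_id_iff)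
qed

lemma of_rat_in_Ints_iff: "(of_rat q :: real) \<in> \<int> \<longleftrightarrow> q \<in> \<int>"
proof
  assume "(of_rat q :: real) \<in> \<int>"
  then obtain k where "(of_rat q :: real) = of_rat (of_int k)" by (auto elim: Ints_cases)
  then show "q \<in> \<int>" by (simp only: of_rat_eq_iff) simp
qed (auto elim: Ints_cases)

lemma rat_rotation_eq_iff: "rat_rotation p = rat_rotation q \<longleftrightarrow> p - q \<in> \<int>"
  by (simp add: rotation_eq_iff of_rat_in_Ints_iff flip: of_rat_diff)

lemma rat_rotation_frac: "rat_rotation (frac q) = rat_rotation q"
  unfolding rat_rotation_eq_iff by (simp add: frac_def)

text \<open>Applying \<open>frac\<close> removes the integer ambiguity of the choice.\<close>

definition angle :: "(circle \<Rightarrow> circle) \<Rightarrow> rat" where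
  "angle r = frac (SOME q. r = rat_rotation q)"

lemma angle_rat_rotation [simp]: "angle (rat_rotation q) = frac q"
proof -
  define p where "p = (SOME p. rat_rotation q = rat_rotation p)"
  have "rat_rotation q = rat_rotation p" unfolding p_def by (rule someI) (rule refl)
  then obtain k where "q = p + of_int k"
    by (auto simp: rat_rotation_eq_iff algebra_simps elim!: Ints_cases)
  then have "frac q = frac p" by (simp add: frac_def)
  then show ?thesis by (simp add: angle_def flip: p_def)
qed

section \<open>Translations of the line as lifts of rotations\<close>

definition translation :: "real \<Rightarrow> real \<Rightarrow> real" where
  "translation a = (\<lambda>x. x + a)"

lemma translation_comp: "translation a \<circ> translation b = translation (a + b)"
  by (auto simp: translation_def)

lemma line_translation_eq: "line_translation k = translation (of_int k)"
  by (simp add: line_translation_def translation_def)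

lemma translation_eq_iff: "translation a = translation b \<longleftrightarrow> a = b"
  by (auto simp: translation_def fun_eq_iff)

lemma translation_bij: "bij (translation a)" and inv_translation: "inv_into UNIV (translation a) = translation (- a)"
proof -
  show "bij (translation a)"
    by (rule o_bij[of "translation (- a)"]) (auto simp: translation_def)
  show "inv_into UNIV (translation a) = translation (- a)"
    by (rule inv_unique_comp) (auto simp: translation_def)
qed

lemma translation_analytic: "real_analytic_at (translation a) x"
proof -
  have "(\<lambda>t. x + a + t) has_fps_expansion (fps_const (x + a) + fps_X)"
    by (intro fps_expansion_intros)
  then show ?thesis unfolding real_analytic_at_def translation_def
    by (auto simp: algebra_simps)
qed

lemma translation_in_carrier: "translation a \<in> carrier Diff_line_periodic"
proof -
  have "deriv (translation a) x = 1" for x unfolding translation_def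
    by (intro DERIV_imp_deriv) (auto intro!: derivative_eq_intros)
  moreover have "translation a (x + 1) = translation a x + 1" for x
    by (simp add: translation_def)
  ultimately show ?thesis
    by (auto simp: Diff_line_periodic_def translation_bij inv_translation translation_analytic)
qed

text \<open>Uniqueness in the description of the inverse follows by cancelling the translation on
  the left.\<close>

lemma m_inv_translation: "inv\<^bsub>Diff_line_periodic\<^esub> translation a = translation (- a)"
proof -
  have m: "F \<otimes>\<^bsub>Diff_line_periodic\<^esub> H = F \<circ> H" "\<one>\<^bsub>Diff_line_periodic\<^esub> = id" for F H
    by (simp_all add: Diff_line_periodic_def)
  have "translation 0 = id" by (auto simp: translation_def)
  then have t: "translation a \<circ> translation (- a) = id" "translation (- a) \<circ> translation a = id"
    by (simp_all add: translation_comp)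
  show ?thesis unfolding m_inv_def m
  proof (rule the_equality)
    fix F assume F: "F \<in> carrier Diff_line_periodic \<and> translation a \<circ> F = id \<and> F \<circ> translation a = id"
    then have "translation (- a) \<circ> (translation a \<circ> F) = translation (- a)" by simp
    then show "F = translation (- a)" by (simp add: t flip: comp_assoc)
  qed (simp add: t translation_in_carrier)
qed

lemma circle_descend_translation: "circle_descend (translation a) = rotation a"
proof
  fix p
  show "circle_descend (translation a) p = rotation a p"
    unfolding circle_descend_def translation_def
    by (metis circle_proj_rep rotation.abs_eq)
qed

section \<open>The Euler cocycle on rational rotations\<close>

text \<open>The lift by a translation in \<open>[0, 1)\<close>; this normalisation turns the
  extension cocycle into the coboundary of \<open>angle\<close>.\<close>

definition rotation_lift :: "(circle \<Rightarrow> circle) \<Rightarrow> real \<Rightarrow> real" where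
  "rotation_lift r = translation (of_rat (angle r))"

lemma circle_descend_rotation_lift:
  assumes "r \<in> carrier SO2_tor"
  shows "circle_descend (rotation_lift r) = r"
  using assms rat_rotation_frac
  by (auto simp: carrier_SO2_tor rotation_lift_def circle_descend_translation)

lemma extension_cocycle_Ints: "w \<in> bar_cells 2 G \<Longrightarrow> extension_cocycle E G \<iota> s w \<in> \<int>"
  by (simp add: extension_cocycle_def)

lemma frac_cocycle_Ints: "frac p + frac q - frac (p + q) \<in> \<int>"
  by (simp add: frac_def)

text \<open>Translations compose additively, so the product of lifts is the translation by the carry
  of the angles, an integer.\<close>

lemma extension_cocycle_SO2_tor:
  assumes s: "\<And>r. r \<in> carrier SO2_tor \<Longrightarrow> s r = rotation_lift r"
    and r: "r1 \<in> carrier SO2_tor" "r2 \<in> carrier SO2_tor"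
  shows "extension_cocycle Diff_line_periodic Diff_circle line_translation s [r1, r2] =
    angle r1 + angle r2 - angle (r1 \<circ> r2)"
proof -
  obtain p q where pq: "r1 = rat_rotation p" "r2 = rat_rotation q"
    using r by (auto simp: carrier_SO2_tor)
  then have r12: "r1 \<circ> r2 = rat_rotation (p + q)" "r1 \<circ> r2 \<in> carrier SO2_tor"
    by (auto simp: rotation_comp carrier_SO2_tor simp flip: of_rat_add)
  obtain k where k: "angle r1 + angle r2 - angle (r1 \<circ> r2) = of_int k"
    using frac_cocycle_Ints[of p q] unfolding r12(1) unfolding pq angle_rat_rotation
    by (auto elim: Ints_cases)
  have "s r1 \<otimes>\<^bsub>Diff_line_periodic\<^esub> s r2 \<otimes>\<^bsub>Diff_line_periodic\<^esub>
      inv\<^bsub>Diff_line_periodic\<^esub> s (r1 \<otimes>\<^bsub>Diff_circle\<^esub> r2) =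
      translation (of_rat (angle r1 + angle r2 - angle (r1 \<circ> r2)))"
    unfolding mult_Diff_circle s[OF r(1)] s[OF r(2)] s[OF r12(2)] rotation_lift_def m_inv_translation
    by (simp add: Diff_line_periodic_def translation_comp of_rat_add of_rat_diff)
  moreover have "(THE j. line_translation j = translation (of_rat (of_int k))) = k"
    by (rule the_equality) (simp_all add: line_translation_eq translation_eq_iff)
  moreover have "[r1, r2] \<in> bar_cells 2 Diff_circle"
    using r carrier_SO2_tor_subset by (auto simp: bar_cells_def)
  ultimately show ?thesis by (simp add: extension_cocycle_def k)
qed

text \<open>Finitely many rational rotations lie in one cyclic subgroup. The bound
  \<open>2 \<le> n\<close> makes \<open>frac (1 / n)\<close> equal to \<open>1 / n\<close>
  later.\<close>

lemma common_denominator: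
  assumes "finite A" "A \<subseteq> carrier SO2_tor"
  shows "\<exists>n\<ge>2. \<forall>r\<in>A. \<exists>i. r = rat_rotation (of_nat i / of_nat n)"
  using assms
proof (induction A rule: finite_induct)
  case empty
  then show ?case by auto
next
  case (insert r A)
  then obtain n where n: "n \<ge> 2" "\<forall>r\<in>A. \<exists>i. r = rat_rotation (of_nat i / of_nat n)" by auto
  \<comment> \<open>Passing to \<open>frac q\<close> makes the numerator nonnegative, hence a
    natural exponent.\<close>
  obtain q where q: "r = rat_rotation (frac q)"
    using insert.prems rat_rotation_frac by (force simp: carrier_SO2_tor)
  obtain a b where ab: "quotient_of (frac q) = (a, b)" by fastforce
  have b: "b > 0" using quotient_of_denom_pos[OF ab] .
  have fq: "frac q = of_int a / of_int b" using quotient_of_div[OF ab] .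
  with b have a: "a \<ge> 0" using frac_ge_0[of q] by (simp add: zero_le_divide_iff)
  have "\<exists>i. s = rat_rotation (of_nat i / of_nat (n * nat b))" if "s \<in> insert r A" for s
  proof (cases "s = r")
    case True
    have "frac q = of_nat (nat a * n) / of_nat (n * nat b)"
      using a b n fq by simp
    then show ?thesis using q True by metis
  next
    case False
    then obtain i where "s = rat_rotation (of_nat i / of_nat n)" using \<open>s \<in> insert r A\<close> n by auto
    moreover have "(of_nat i / of_nat n :: rat) = of_nat (i * nat b) / of_nat (n * nat b)"
      using b by simp
    ultimately show ?thesis by metis
  qed
  moreover have "n * nat b \<ge> 2" using n b mult_le_mono[of 2 n 1 "nat b"] by simp
  ultimately show ?case by blast
qed

lemma cyclic_param_rat_rotation:
  assumes "0 < n"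
  shows "cyclic_param SO2_tor (\<lambda>i. rat_rotation (of_nat i / of_nat n)) n"
proof
  show "rat_rotation (of_nat i / of_nat n) = rat_rotation (of_nat j / of_nat n)
      \<longleftrightarrow> i mod n = j mod n" for i j
  proof -
    have "(of_nat i / of_nat n - of_nat j / of_nat n :: rat) \<in> \<int> \<longleftrightarrow> int n dvd int i - int j"
    proof
      assume "(of_nat i / of_nat n - of_nat j / of_nat n :: rat) \<in> \<int>"
      then obtain k where "(of_nat i / of_nat n - of_nat j / of_nat n :: rat) = of_int k"
        by (auto elim: Ints_cases)
      then have "(of_int (int i - int j) :: rat) = of_int (int n * k)"
        using assms by (simp add: field_simps)
      then show "int n dvd int i - int j" by (simp only: of_int_eq_iff) simp
    next
      assume "int n dvd int i - int j"
      then obtain k where "int i - int j = int n * k" by auto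
      then have "(of_int (int i - int j) :: rat) = of_int (int n * k)" by simp
      then have "(of_nat i / of_nat n - of_nat j / of_nat n :: rat) = of_int k"
        using assms by (simp add: field_simps)
      then show "(of_nat i / of_nat n - of_nat j / of_nat n :: rat) \<in> \<int>" by simp
    qed
    also have "\<dots> \<longleftrightarrow> i mod n = j mod n"
      by (metis mod_eq_dvd_iff of_nat_eq_iff of_nat_mod)
    finally show ?thesis by (simp add: rat_rotation_eq_iff)
  qed
qed (use assms in \<open>simp_all add: carrier_SO2_tor mult_SO2_tor rotation_comp add_divide_distrib
      flip: of_rat_add\<close>)

text \<open>The carries telescope; over a full period they sum to 1, and the first angle contributes
  the constant factor \<open>1 / n\<close>.\<close>

lemma norm_cycle_pairing:
  fixes n :: nat
  assumes "2 \<le> n"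
  shows "(\<Sum>k<n. frac (1 / of_nat n :: rat)
      * (frac (of_nat k / of_nat n) + frac (1 / of_nat n) - frac (of_nat (k + 1) / of_nat n)))
    = 1 / of_nat n"
proof -
  have f: "frac (1 / of_nat n :: rat) = 1 / of_nat n" using assms by (simp add: frac_eq)
  have "(\<Sum>k<m. frac (of_nat k / of_nat n) + 1 / of_nat n - frac (of_nat (k + 1) / of_nat n)) =
      of_nat m / of_nat n - (frac (of_nat m / of_nat n) :: rat)" for m
    by (induction m) (simp_all add: add_divide_distrib algebra_simps)
  from this[of n] show ?thesis using assms
    unfolding sum_distrib_left[symmetric] f by simp
qed

text \<open>Both \<open>u\<close> and \<open>\<theta>e\<close> have coboundary \<open>ee\<close>, so
  they agree on boundaries, in particular on \<open>n\<close> times \<open>norm_cycle 1\<close>.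
  Dividing by \<open>n\<close> gives \<open>u\<close> the value \<open>1 / n\<close> on
  \<open>norm_cycle 1\<close>.\<close>

lemma SO2_tor_boundary_if_pairing_Ints:
  fixes u :: "(circle \<Rightarrow> circle) list \<Rightarrow> rat" and e :: "(circle \<Rightarrow> circle) list \<Rightarrow> rat"
  assumes e: "\<And>r s. r \<in> carrier SO2_tor \<Longrightarrow> s \<in> carrier SO2_tor \<Longrightarrow>
      e [r, s] = angle r + angle s - angle (r \<circ> s)"
    and u: "\<And>w. w \<in> bar_cells 4 SO2_tor \<Longrightarrow>
      bar_coboundary SO2_tor 3 u w = e (take 2 w) * e (drop 2 w)"
    and x: "x \<in> bar_cycles 3 SO2_tor"
    and int: "chain_eval u x \<in> \<int>"
  shows "x \<in> bar_boundaries 3 SO2_tor"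
proof -
  define ee where "ee = (\<lambda>w. e (take 2 w) * e (drop 2 w))"
  \<comment> \<open>On rational rotations \<open>e\<close> is the coboundary of \<open>angle\<close>, so \<open>ee\<close> is that of \<open>\<theta>e\<close>.\<close>
  define \<theta>e where "\<theta>e = (\<lambda>w. angle (w ! 0) * e (drop 1 w))"
  have e_Ints: "e [r, s] \<in> \<int>" if "r \<in> carrier SO2_tor" "s \<in> carrier SO2_tor" for r s
    using that frac_cocycle_Ints unfolding carrier_SO2_tor
    by (auto simp: e carrier_SO2_tor rotation_comp simp flip: of_rat_add)
  have cells: "\<exists>a b c d. w = [a, b, c, d] \<and> {a, b, c, d} \<subseteq> carrier SO2_tor"
    if "w \<in> bar_cells 4 SO2_tor" for w
    using that by (auto simp: bar_cells_def eval_nat_numeral length_Suc_conv)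
  have comp_closed: "r \<circ> s \<in> carrier SO2_tor"
    if "r \<in> carrier SO2_tor" "s \<in> carrier SO2_tor" for r s
    using that by (auto simp: carrier_SO2_tor rotation_comp simp flip: of_rat_add)
  have \<theta>e: "bar_coboundary SO2_tor 3 \<theta>e w = ee w" if w4: "w \<in> bar_cells 4 SO2_tor" for w
  proof -
    obtain a b c d where w: "w = [a, b, c, d]" and abcd: "{a, b, c, d} \<subseteq> carrier SO2_tor"
      using cells[OF w4] by metis
    \<comment> \<open>The Leibniz rule with \<open>e\<close> closed; in terms of angles it is a
      polynomial identity.\<close>
    show ?thesis
      unfolding w bar_coboundary_3[OF abcd] using abcd
      by (simp add: \<theta>e_def ee_def e comp_closed mult_SO2_tor comp_assoc) algebra
  qed
  have eval_bd: "chain_eval u (bar_boundary SO2_tor 4 z) = chain_eval ee z"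
    "chain_eval \<theta>e (bar_boundary SO2_tor 4 z) = chain_eval ee z" "chain_eval ee z \<in> \<int>"
    if z: "Poly_Mapping.keys z \<subseteq> bar_cells 4 SO2_tor" for z
  proof -
    have "chain_eval v (bar_boundary SO2_tor 4 z) = chain_eval ee z"
      if "\<And>w. w \<in> bar_cells 4 SO2_tor \<Longrightarrow> bar_coboundary SO2_tor 3 v w = ee w" for v
      using chain_eval_boundary[of z 3 SO2_tor v] z that
      by (auto simp: intro!: chain_eval_cong)
    then show "chain_eval u (bar_boundary SO2_tor 4 z) = chain_eval ee z"
      "chain_eval \<theta>e (bar_boundary SO2_tor 4 z) = chain_eval ee z"
      using u \<theta>e by (simp_all add: ee_def)
    show "chain_eval ee z \<in> \<int>"
      using z cells by (intro chain_eval_Ints) (force simp: ee_def intro!: Ints_mult e_Ints)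
  qed
  have x_keys: "Poly_Mapping.keys x \<subseteq> bar_cells 3 SO2_tor" and x_bd: "bar_boundary SO2_tor 3 x = 0"
    using x by (auto simp: bar_cycles_def kernel_def bar_chain_group_def)
  define A where "A = (\<Union>w\<in>Poly_Mapping.keys x. set w)"
  have "finite A" "A \<subseteq> carrier SO2_tor"
    using x_keys by (auto simp: A_def bar_cells_def)
  then obtain n where n: "n \<ge> 2" "\<forall>r\<in>A. \<exists>i. r = rat_rotation (of_nat i / of_nat n)"
    using common_denominator by blast
  define t where "t = (\<lambda>i. rat_rotation (of_nat i / of_nat n))"
  interpret cyclic_param SO2_tor t n
    unfolding t_def using n by (intro cyclic_param_rat_rotation) simp
  have "Poly_Mapping.keys x \<subseteq> {w. length w = 3 \<and> set w \<subseteq> range t}"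
    using x_keys n(2) by (fastforce simp: bar_cells_def A_def t_def)
  then obtain m where m: "x - frag_cmul m (norm_cycle 1) \<in> B"
    using cycle_homologous_multiple_norm x_bd by blast
  then obtain z where z: "Poly_Mapping.keys z \<subseteq> bar_cells 4 SO2_tor"
    "x - frag_cmul m (norm_cycle 1) = bar_boundary SO2_tor 4 z"
    by (auto simp: bar_boundaries_iff)
  obtain y where y: "Poly_Mapping.keys y \<subseteq> bar_cells 4 SO2_tor"
    "frag_cmul (int n) (norm_cycle 1) = bar_boundary SO2_tor 4 y"
    using cmul_norm_cycle_boundary by (auto simp: bar_boundaries_iff)
  have angle_t: "angle (t i) = frac (of_nat i / of_nat n)" for i
    by (simp add: t_def)
  have "chain_eval \<theta>e (norm_cycle 1) = 1 / of_nat n"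
    using norm_cycle_pairing[OF n(1)]
    by (simp add: norm_cycle_def chain_eval_sum \<theta>e_def e t_carrier angle_t t_add[unfolded mult_SO2_tor])
  moreover have "chain_eval u (frag_cmul (int n) (norm_cycle 1)) =
      chain_eval \<theta>e (frag_cmul (int n) (norm_cycle 1))"
    using eval_bd[OF y(1)] y(2) by simp
  ultimately have uN: "chain_eval u (norm_cycle 1) = 1 / of_nat n"
    using n by (auto simp: chain_eval_cmul eq_divide_eq mult.commute)
  \<comment> \<open>The chain \<open>x - frag_cmul m (norm_cycle 1)\<close> bounds, and
    \<open>u\<close> is integral on boundaries because \<open>ee\<close> is integral; this forces
    \<open>n\<close> to divide \<open>m\<close>.\<close>
  have "of_int m / of_nat n = chain_eval u x - chain_eval u (x - frag_cmul m (norm_cycle 1))"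
    unfolding chain_eval_diff chain_eval_cmul uN by simp
  also have "\<dots> \<in> \<int>"
    using int eval_bd[OF z(1)] z(2) by (simp add: Ints_diff)
  finally obtain l where "(of_int m / of_nat n :: rat) = of_int l" by (auto elim: Ints_cases)
  then have "(of_int m :: rat) = of_int (l * int n)" using n by (simp add: field_simps)
  then have "m = l * int n" by (simp only: of_int_eq_iff)
  then have "frag_cmul m (norm_cycle 1) \<in> B"
    using bar_boundaries_cmul[OF cmul_norm_cycle_boundary, of l] by simp
  from bar_boundaries_add[OF m this] show ?thesis by simp
qed

section \<open>The square of the Euler class\<close>

lemma bar_cells_SO2_tor_subset: "bar_cells n SO2_tor \<subseteq> bar_cells n Diff_circle"
  using carrier_SO2_tor_subset by (auto simp: bar_cells_def)

lemma bar_boundaries_SO2_tor_subset: "bar_boundaries n SO2_tor \<subseteq> bar_boundaries n Diff_circle"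
proof -
  have "bar_boundary SO2_tor m = bar_boundary Diff_circle m" for m
    by (simp add: fun_eq_iff bar_boundary_def bar_face_SO2_tor)
  then show ?thesis
    using bar_cells_SO2_tor_subset[of "Suc n"] unfolding bar_boundaries_def
    by (auto simp: bar_chain_group_def intro!: image_mono)
qed

text \<open>The witness is the difference of representatives of two distinct classes with the same
  image.\<close>

lemma group_homology_map_SO2_tor_not_injE:
  assumes "\<not> inj_on (group_homology_map n SO2_tor Diff_circle (\<lambda>r. r))
                    (carrier (group_homology n SO2_tor))"
  obtains x where "x \<in> bar_cycles n SO2_tor" "x \<in> bar_boundaries n Diff_circle"
    "x \<notin> bar_boundaries n SO2_tor"
proof -
  let ?K = "(bar_chain_group n SO2_tor)\<lparr>carrier := bar_cycles n SO2_tor\<rparr>"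
  let ?f = "group_homology_map n SO2_tor Diff_circle (\<lambda>r. r)"
  have coset: "B #>\<^bsub>bar_chain_group n G\<^esub> c = (\<lambda>b. b + c) ` B" for B c and G :: "('c, 'd) monoid_scheme"
    by (auto simp: r_coset_def bar_chain_group_def)
  have cosetK: "B #>\<^bsub>?K\<^esub> c = (\<lambda>b. b + c) ` B" for B c
    by (auto simp: r_coset_def bar_chain_group_def)
  have carrier: "carrier (group_homology n SO2_tor) =
      (\<Union>c\<in>bar_cycles n SO2_tor. {(\<lambda>b. b + c) ` bar_boundaries n SO2_tor})"
    unfolding group_homology_def FactGroup_def RCOSETS_def cosetK by simp
  have f: "?f X = (\<Union>c\<in>X. (\<lambda>b. b + c) ` bar_boundaries n Diff_circle)"
    if "X \<in> carrier (group_homology n SO2_tor)" for X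
    using that unfolding group_homology_map_def coset
    by (simp add: comp_def flip: frag_expansion)
  obtain X Y where XY: "X \<in> carrier (group_homology n SO2_tor)"
    "Y \<in> carrier (group_homology n SO2_tor)" "?f X = ?f Y" "X \<noteq> Y"
    using assms by (auto simp: inj_on_def)
  obtain c d where c: "c \<in> bar_cycles n SO2_tor" "X = (\<lambda>b. b + c) ` bar_boundaries n SO2_tor"
    and d: "d \<in> bar_cycles n SO2_tor" "Y = (\<lambda>b. b + d) ` bar_boundaries n SO2_tor"
    using XY(1,2) by (auto simp: carrier)
  have "c \<in> X" unfolding c(2) by (rule image_eqI[of _ _ 0]) simp_all
  then have "c \<in> ?f X" unfolding f[OF XY(1)]
    by (intro UN_I image_eqI[of _ _ 0]) simp_all
  then obtain d' b where d': "d' \<in> Y" "b \<in> bar_boundaries n Diff_circle" "c = b + d'"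
    using XY(3) f[OF XY(2)] by auto
  then obtain b' where b': "b' \<in> bar_boundaries n SO2_tor" "d' = b' + d" using d by auto
  show ?thesis
  proof
    show "c - d \<in> bar_cycles n SO2_tor" using c(1) d(1) keys_diff[of c d]
      by (auto simp: bar_cycles_def kernel_def bar_chain_group_def bar_boundary_diff)
    have "b' \<in> bar_boundaries n Diff_circle"
      using b'(1) bar_boundaries_SO2_tor_subset by blast
    from bar_boundaries_add[OF d'(2) this] show "c - d \<in> bar_boundaries n Diff_circle"
      by (simp add: d'(3) b'(2) add.assoc)
    show "c - d \<notin> bar_boundaries n SO2_tor"
    proof
      assume cd: "c - d \<in> bar_boundaries n SO2_tor"
      have "\<exists>b'\<in>bar_boundaries n SO2_tor. b + c = b' + d"
        if "b \<in> bar_boundaries n SO2_tor" for b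
        by (rule bexI[OF _ bar_boundaries_add[OF that cd]]) simp
      moreover have "\<exists>b'\<in>bar_boundaries n SO2_tor. b + d = b' + c"
        if "b \<in> bar_boundaries n SO2_tor" for b
        by (rule bexI[OF _ bar_boundaries_diff[OF that cd]]) simp
      ultimately have "X = Y" unfolding c(2) d(2) by (auto simp: image_iff)
      with XY(4) show False by contradiction
    qed
  qed
qed

section \<open>Faces of cells and cosets of coboundaries\<close>

lemma bar_face_in_bar_cells:
  assumes "\<And>a b. a \<in> carrier G \<Longrightarrow> b \<in> carrier G \<Longrightarrow> a \<otimes>\<^bsub>G\<^esub> b \<in> carrier G"
    and w: "w \<in> bar_cells (Suc n) G" and i: "i \<le> Suc n"
  shows "bar_face G i w \<in> bar_cells n G"
proof -
  have l: "length w = Suc n" and sub: "set w \<subseteq> carrier G" using w by (auto simp: bar_cells_def)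
  have nth: "w ! j \<in> carrier G" if "j < Suc n" for j
    using sub l nth_mem that by (metis subsetD)
  consider "i = 0" | "i = Suc n" | "0 < i" "i < Suc n" using i by linarith
  then show ?thesis
  proof cases
    case 1
    then show ?thesis using l sub
      by (cases w) (auto simp: bar_face_def bar_cells_def)
  next
    case 2
    then show ?thesis using l sub
      by (auto simp: bar_face_def bar_cells_def dest: in_set_butlastD)
  next
    case 3
    then have "w ! (i - 1) \<otimes>\<^bsub>G\<^esub> w ! i \<in> carrier G" using assms(1) nth by auto
    then show ?thesis using 3 l sub
      by (auto simp: bar_face_def bar_cells_def dest: in_set_takeD in_set_dropD)
  qed
qed

text \<open>Cochains are extensional functions, so the coboundary of the zero cochain is zero only
  if the faces of cells are again cells, i.e. if the multiplication is closed.\<close>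

lemma in_coboundaries_coset:
  fixes f :: "'a list \<Rightarrow> 'r::comm_ring_1"
  assumes closed: "\<And>a b. a \<in> carrier G \<Longrightarrow> b \<in> carrier G \<Longrightarrow> a \<otimes>\<^bsub>G\<^esub> b \<in> carrier G"
    and f: "f \<in> extensional (bar_cells (Suc n) G)"
  shows "f \<in> bar_coboundaries (Suc n) G #>\<^bsub>bar_cochain_group (Suc n) G\<^esub> f"
proof -
  let ?z = "(\<lambda>w\<in>bar_cells n G. 0) :: 'a list \<Rightarrow> 'r"
  have "bar_coboundary G n ?z \<in> bar_coboundaries (Suc n) G"
    by (auto simp: bar_coboundaries_def bar_cochain_group_def)
  moreover have "bar_coboundary G n ?z = (\<lambda>w\<in>bar_cells (Suc n) G. 0)"
    unfolding bar_coboundary_def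
    by (intro restrict_ext sum.neutral ballI) (use bar_face_in_bar_cells[OF closed] in auto)
  moreover have "(\<lambda>w\<in>bar_cells (Suc n) G. 0) \<otimes>\<^bsub>bar_cochain_group (Suc n) G\<^esub> f = f"
    using f by (auto simp: bar_cochain_group_def extensional_def fun_eq_iff)
  ultimately show ?thesis unfolding r_coset_def by fastforce
qed

theorem proposition1p12:
  assumes "\<not> inj_on (group_homology_map 3 SO2_tor Diff_circle (\<lambda>r. r))
                    (carrier (group_homology 3 SO2_tor))"
  shows "cup_product Diff_circle 2 2 euler_class euler_class
           \<noteq> \<one>\<^bsub>group_cohomology 4 Diff_circle\<^esub>"
proof
  assume "cup_product Diff_circle 2 2 euler_class euler_class = \<one>\<^bsub>group_cohomology 4 Diff_circle\<^esub>"
  \<comment> \<open>The neutral element of the quotient is the subgroup itself.\<close>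
  then have cup: "cup_product Diff_circle 2 2 euler_class euler_class = bar_coboundaries 4 Diff_circle"
    by (simp add: group_cohomology_def FactGroup_def)
  have closed: "f \<otimes>\<^bsub>Diff_circle\<^esub> g \<in> carrier Diff_circle"
    if "f \<in> carrier Diff_circle" "g \<in> carrier Diff_circle" for f g
    using that by (simp add: mult_Diff_circle Diff_circle_comp_closed)
  have "bar_coboundary Diff_circle 3 (\<lambda>w\<in>bar_cells 3 Diff_circle. 0)
      \<in> (bar_coboundaries 4 Diff_circle :: ((circle \<Rightarrow> circle) list \<Rightarrow> rat) set)"
    by (auto simp: bar_coboundaries_def bar_cochain_group_def)
  \<comment> \<open>This gives a section without lifting diffeomorphisms: an empty \<open>euler_class\<close> makes the cup
    product the empty set, which is not the neutral element.\<close>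
  then have "euler_class \<noteq> {}" using cup by (auto simp: cup_product_def)
  then obtain s0 where s0: "s0 \<in> extension_sections Diff_line_periodic Diff_circle circle_descend"
    by (auto simp: euler_class_def extension_class_def)
  \<comment> \<open>As \<open>euler_class\<close> is a union over all sections, the section may be
    changed on rational rotations to the normalised lift.\<close>
  define s where "s = (\<lambda>r. if r \<in> carrier SO2_tor then rotation_lift r else s0 r)"
  have s: "s \<in> extension_sections Diff_line_periodic Diff_circle circle_descend"
    using s0 circle_descend_rotation_lift translation_in_carrier
    by (auto simp: s_def extension_sections_def rotation_lift_def)
  define e :: "(circle \<Rightarrow> circle) list \<Rightarrow> rat"
    where "e = extension_cocycle Diff_line_periodic Diff_circle line_translation s"
  define ee where "ee = cochain_cup Diff_circle 2 2 e e"
  have "e \<in> bar_coboundaries 2 Diff_circle #>\<^bsub>bar_cochain_group 2 Diff_circle\<^esub> e"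
    using in_coboundaries_coset[where n = 1 and G = Diff_circle and f = e, OF closed]
    by (simp add: e_def extension_cocycle_def eval_nat_numeral)
  then have e: "e \<in> euler_class"
    using s unfolding euler_class_def extension_class_def e_def by blast
  have "ee \<in> bar_coboundaries 4 Diff_circle #>\<^bsub>bar_cochain_group 4 Diff_circle\<^esub> ee"
    using in_coboundaries_coset[where n = 3 and G = Diff_circle and f = ee, OF closed]
    by (simp add: ee_def cochain_cup_def eval_nat_numeral)
  then have "ee \<in> cup_product Diff_circle 2 2 euler_class euler_class"
    using e unfolding cup_product_def ee_def by auto
  then obtain u where u: "ee = bar_coboundary Diff_circle 3 u"
    unfolding cup by (auto simp: bar_coboundaries_def)
  have ee: "ee w = e (take 2 w) * e (drop 2 w)" if "w \<in> bar_cells 4 Diff_circle" for w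
    using that by (simp add: ee_def cochain_cup_def)
  obtain x where x: "x \<in> bar_cycles 3 SO2_tor" "x \<in> bar_boundaries 3 Diff_circle"
    "x \<notin> bar_boundaries 3 SO2_tor"
    using group_homology_map_SO2_tor_not_injE[OF assms] .
  then obtain y where y: "Poly_Mapping.keys y \<subseteq> bar_cells 4 Diff_circle"
    "x = bar_boundary Diff_circle 4 y"
    by (auto simp: bar_boundaries_iff)
  have td: "take 2 w \<in> bar_cells 2 Diff_circle" "drop 2 w \<in> bar_cells 2 Diff_circle"
    if "w \<in> bar_cells 4 Diff_circle" for w
    using that by (auto simp: bar_cells_def dest: in_set_takeD in_set_dropD)
  have "ee w \<in> \<int>" if "w \<in> bar_cells 4 Diff_circle" for w
    unfolding ee[OF that] e_def by (intro Ints_mult extension_cocycle_Ints td that)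
  then have "chain_eval ee y \<in> \<int>"
    using y(1) by (intro chain_eval_Ints) blast
  \<comment> \<open>By adjointness, \<open>u\<close> on the boundary \<open>x\<close> of
    \<open>y\<close> equals \<open>ee\<close> on \<open>y\<close>.\<close>
  then have "chain_eval u x \<in> \<int>"
    using chain_eval_boundary[of y 3 Diff_circle u] y by (simp add: u)
  moreover have "bar_coboundary SO2_tor 3 u w = e (take 2 w) * e (drop 2 w)"
    if "w \<in> bar_cells 4 SO2_tor" for w
  proof -
    have "w \<in> bar_cells 4 Diff_circle" using that bar_cells_SO2_tor_subset by blast
    then show ?thesis using that ee[of w]
      by (simp add: u bar_coboundary_def bar_face_SO2_tor)
  qed
  moreover have "e [r1, r2] = angle r1 + angle r2 - angle (r1 \<circ> r2)"
    if "r1 \<in> carrier SO2_tor" "r2 \<in> carrier SO2_tor" for r1 r2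
    using that unfolding e_def by (intro extension_cocycle_SO2_tor) (simp_all add: s_def)
  ultimately have "x \<in> bar_boundaries 3 SO2_tor"
    using x(1) by (intro SO2_tor_boundary_if_pairing_Ints)
  with x(3) show False by contradiction
qed

end
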